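(* Let $D$ be an $m$-colored digraph such that every directed cycle of $D$ is monochromatic. Then $D$ has a $k$-colored kernel for every integer $k\geq 1$.
   Context: Digraphs are finite, nonempty, without loops or parallel arcs (pairs of opposite arcs are allowed, and such a pair forms a directed cycle of length 2); $V(D)$ and $A(D)$ denote the vertex and arc sets of $D$. A digraph $D$ is $m$-colored ($m$ a positive integer) if its arcs are colored with $m$ colors (each arc receives one color; no properness condition). A subdigraph is monochromatic if all its arcs have the same color. Directed paths have no repeated vertices. For a positive integer $j$, a directed path is $j$-colored if its arcs use exactly $j$ colors; $u\leadsto_j v$ denotes a $j$-colored directed path from $u$ to $v$. For a positive integer $k$, a nonempty set $K\subseteq V(D)$ is a $k$-colored kernel of $D$ if it is both: (a) $k$-colored absorbent: for every $u\in V(D)\setminus K$ there exist $v\in K$ and $1\leq j\leq k$ with a path $u\leadsto_j v$ in $D$; and (b) $k$-colored independent: for all distinct $u,v\in K$ there is no path $u\leadsto_j v$ with $1\leq j\leq k$. *)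

theory Defs
  imports "Graph_Theory.Arc_Walk"
begin

(* Colors are the numbers 1..m; a coloring need not use every one of them. *)
definition arc_coloring :: "('a, 'b) pre_digraph \<Rightarrow> nat \<Rightarrow> ('b \<Rightarrow> nat) \<Rightarrow> bool" where
  "arc_coloring G m c \<longleftrightarrow> m \<ge> 1 \<and> c ` arcs G \<subseteq> {1..m}"

(* The argument is the set of arcs of a subdigraph. *)
definition monochromatic :: "('b \<Rightarrow> nat) \<Rightarrow> 'b set \<Rightarrow> bool" where
  "monochromatic c A \<longleftrightarrow> (\<forall>e\<in>A. \<forall>f\<in>A. c e = c f)"

definition colored_path ::
  "('a, 'b) pre_digraph \<Rightarrow> ('b \<Rightarrow> nat) \<Rightarrow> nat \<Rightarrow> 'a \<Rightarrow> 'b awalk \<Rightarrow> 'a \<Rightarrow> bool" where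
  "colored_path G c j u p v \<longleftrightarrow> pre_digraph.apath G u p v \<and> card (c ` set p) = j"

definition colored_absorbent ::
  "('a, 'b) pre_digraph \<Rightarrow> ('b \<Rightarrow> nat) \<Rightarrow> nat \<Rightarrow> 'a set \<Rightarrow> bool" where
  "colored_absorbent G c k K \<longleftrightarrow>
     (\<forall>u \<in> verts G - K. \<exists>v\<in>K. \<exists>j\<in>{1..k}. \<exists>p. colored_path G c j u p v)"

definition colored_independent ::
  "('a, 'b) pre_digraph \<Rightarrow> ('b \<Rightarrow> nat) \<Rightarrow> nat \<Rightarrow> 'a set \<Rightarrow> bool" where
  "colored_independent G c k K \<longleftrightarrow>
     (\<forall>u\<in>K. \<forall>v\<in>K. u \<noteq> v \<longrightarrow> \<not> (\<exists>j\<in>{1..k}. \<exists>p. colored_path G c j u p v))"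

definition colored_kernel ::
  "('a, 'b) pre_digraph \<Rightarrow> ('b \<Rightarrow> nat) \<Rightarrow> nat \<Rightarrow> 'a set \<Rightarrow> bool" where
  "colored_kernel G c k K \<longleftrightarrow> K \<noteq> {} \<and> K \<subseteq> verts G \<and>
     colored_absorbent G c k K \<and> colored_independent G c k K"

end

theory Submission
  imports Defs
begin

text \<open>
  Call \<open>v\<close> \<^emph>\<open>close\<close> to \<open>u\<close> if some path from \<open>u\<close> to \<open>v\<close> uses between \<open>1\<close> and \<open>k\<close> colors. A
  \<open>k\<close>-colored kernel of the digraph is then an ordinary kernel of the closeness relation, and by
  Duchet's theorem (\<open>kernel_if_asymmetric_part_acyclic\<close>) a finite relation has a kernel if every
  cycle in it contains a symmetric arc.

  Closeness has this property, because it is even symmetric inside each strong component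
  (\<open>colored_path_reverse\<close>). Indeed, let a path run from \<open>u\<close> to \<open>v\<close> inside a strong component. Each
  of its arcs \<open>e\<close> can be completed to a directed cycle; the cycle is monochromatic, so the
  rest of it is a detour that undoes \<open>e\<close> using only the color of \<open>e\<close>
  (\<open>monochromatic_return_path\<close>). Chaining these detours in reverse order leads from \<open>v\<close> back to
  \<open>u\<close> without any new color. A cycle of closeness stays within one strong component, so
  all its arcs are symmetric.
\<close>

text \<open>
  Duchet's theorem. Acyclicity provides a vertex \<open>v\<close> all of whose out-neighbours are also
  in-neighbours. Put \<open>v\<close> into the kernel, discard its in-neighbours, and recurse: the vertices
  that remain are not joined to \<open>v\<close> in either direction.
\<close>

lemma kernel_if_asymmetric_part_acyclic:
  fixes R :: "'a \<Rightarrow> 'a \<Rightarrow> bool"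
  assumes "finite V"
    and "acyclic {(u, v). u \<in> V \<and> v \<in> V \<and> R u v \<and> \<not> R v u}"
  shows "\<exists>K\<subseteq>V. (\<forall>u\<in>V - K. \<exists>v\<in>K. R u v) \<and> (\<forall>u\<in>K. \<forall>v\<in>K. u \<noteq> v \<longrightarrow> \<not> R u v)"
  using assms
proof (induction V rule: finite_psubset_induct)
  case (psubset V)
  let ?A = "\<lambda>W. {(u, v). u \<in> W \<and> v \<in> W \<and> R u v \<and> \<not> R v u}"
  show ?case
  proof (cases "V = {}")
    case False
    have "finite (?A V)"
      by (rule finite_subset[of _ "V \<times> V"]) (auto simp: psubset.hyps)
    then have "wf ((?A V)\<inverse>)"
      using psubset.prems by (rule finite_acyclic_wf_converse)
    then obtain v where v: "v \<in> V" and min: "\<And>w. (w, v) \<in> (?A V)\<inverse> \<Longrightarrow> w \<notin> V"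
      using wfE_min'[of "(?A V)\<inverse>" V] False by blast
    have out: "R w v" if "w \<in> V" "R v w" for w
      using v min[of w] that by blast
    define W where "W = V - {v} - {w. R w v}"
    have "W \<subset> V"
      using v by (auto simp: W_def)
    moreover have "acyclic (?A W)"
      by (rule acyclic_subset[OF psubset.prems]) (auto simp: W_def)
    ultimately obtain K where K: "K \<subseteq> W"
      and absorbs: "\<forall>u\<in>W - K. \<exists>w\<in>K. R u w"
      and indep: "\<forall>u\<in>K. \<forall>w\<in>K. u \<noteq> w \<longrightarrow> \<not> R u w"
      using psubset.IH[of W] by blast
    have "insert v K \<subseteq> V"
      using K v by (auto simp: W_def)
    moreover have "\<forall>u\<in>V - insert v K. \<exists>w\<in>insert v K. R u w"
      using absorbs by (auto simp: W_def)
    moreover have "\<forall>u\<in>insert v K. \<forall>w\<in>insert v K. u \<noteq> w \<longrightarrow> \<not> R u w"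
      using K indep out by (auto simp: W_def)
    ultimately show ?thesis
      by blast
  qed simp
qed

context wf_digraph
begin

lemma monochromatic_return_path:
  assumes cycles: "\<And>p. cycle p \<Longrightarrow> monochromatic c (set p)"
    and e: "e \<in> arcs G"
    and return_walk: "awalk (head G e) q (tail G e)"
  shows "\<exists>p. awalk (head G e) p (tail G e) \<and> c ` set p \<subseteq> {c e}"
proof -
  let ?p = "awalk_to_apath q"
  have p: "apath (head G e) ?p (tail G e)"
    using return_walk by (rule apath_awalk_to_apath)
  then have "cycle (e # ?p)"
    using e unfolding cycle_def apath_def
    by (intro exI[of _ "tail G e"]) (simp add: awalk_Cons_iff)
  then have "c ` set ?p \<subseteq> {c e}"
    using cycles unfolding monochromatic_def by fastforce
  then show ?thesis
    using p by (auto simp: apath_def)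
qed

text \<open>
  Induction along the walk, undoing its last arcs first. The return walk from \<open>v\<close> certifies that
  all its arcs lie in one strong component; it serves each suffix of the walk once the arcs already
  passed are appended to it.
\<close>

lemma awalk_reverse_no_new_colors:
  assumes cycles: "\<And>p. cycle p \<Longrightarrow> monochromatic c (set p)"
    and "awalk u p v" and "awalk v q u"
  shows "\<exists>r. awalk v r u \<and> c ` set r \<subseteq> c ` set p"
  using assms(2,3)
proof (induction p arbitrary: u q)
  case Nil
  then show ?case
    by (intro exI[of _ "[]"]) (auto simp: awalk_Nil_iff)
next
  case (Cons e p)
  then have e: "e \<in> arcs G" "u = tail G e" and p: "awalk (head G e) p v"
    by (auto simp: awalk_Cons_iff)
  have "awalk v (q @ [e]) (head G e)"
    using Cons.prems(2) arc_implies_awalk[OF e(1)] e(2) by (blast intro: awalk_appendI)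
  then obtain r where r: "awalk v r (head G e)" "c ` set r \<subseteq> c ` set p"
    using Cons.IH[OF p] by blast
  obtain s where s: "awalk (head G e) s u" "c ` set s \<subseteq> {c e}"
    using monochromatic_return_path[OF cycles e(1), of "p @ q"]
      awalk_appendI[OF p Cons.prems(2)] e(2) by blast
  have "awalk v (r @ s) u"
    using r(1) s(1) by (rule awalk_appendI)
  moreover have "c ` set (r @ s) \<subseteq> c ` set (e # p)"
    using r(2) s(2) by auto
  ultimately show ?case
    by blast
qed

lemma colored_path_reverse:
  assumes cycles: "\<And>p. cycle p \<Longrightarrow> monochromatic c (set p)"
    and path: "colored_path G c j u p v" and j: "j \<in> {1..k}"
    and return_walk: "awalk v q u"
  shows "\<exists>i\<in>{1..k}. \<exists>r. colored_path G c i v r u"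
proof -
  have p: "apath u p v" and card_p: "card (c ` set p) = j"
    using path by (auto simp: colored_path_def)
  have "p \<noteq> []"
    using card_p j by auto
  then have "u \<noteq> v"
    using p by (rule apath_nonempty_ends[rotated])
  obtain r where r: "awalk v r u" "c ` set r \<subseteq> c ` set p"
    using awalk_reverse_no_new_colors[OF cycles awalkI_apath[OF p] return_walk] by blast
  let ?r = "awalk_to_apath r"
  have path_r: "apath v ?r u"
    using r(1) by (rule apath_awalk_to_apath)
  have "c ` set ?r \<subseteq> c ` set p"
    using awalk_to_apath_subset[OF r(1)] r(2) by blast
  then have "card (c ` set ?r) \<le> k"
    using card_mono[of "c ` set p" "c ` set ?r"] card_p j by simp
  \<comment> \<open>The lower bound \<open>1\<close> on the number of colors holds because a path between distinct ends has an arc.\<close>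
  moreover have "?r \<noteq> []"
    using path_r \<open>u \<noteq> v\<close> by (auto simp: apath_Nil_iff)
  ultimately show ?thesis
    using path_r by (auto simp: colored_path_def Suc_le_eq card_gt_0_iff)
qed

end

theorem theorem11:
  fixes D :: "('a, 'b) pre_digraph" and m :: nat and c :: "'b \<Rightarrow> nat"
  assumes "digraph D" and "verts D \<noteq> {}"
    and "arc_coloring D m c"
    and "\<And>p. pre_digraph.cycle D p \<Longrightarrow> monochromatic c (set p)"
  shows "\<forall>k\<ge>1. \<exists>K. colored_kernel D c k K"
proof (intro allI impI)
  fix k :: nat
  interpret digraph D
    by fact
  let ?close = "\<lambda>u v. \<exists>j\<in>{1..k}. \<exists>p. colored_path D c j u p v"
  let ?A = "{(u, v). u \<in> verts D \<and> v \<in> verts D \<and> ?close u v \<and> \<not> ?close v u}"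
  have walk: "\<exists>p. awalk u p v" if "(u, v) \<in> ?A\<^sup>+" for u v
    using that
  proof (induction rule: trancl_induct)
    case (base v)
    then show ?case
      by (auto simp: colored_path_def apath_def)
  next
    case (step v w)
    then have "\<exists>p. awalk v p w"
      by (auto simp: colored_path_def apath_def)
    with step.IH show ?case
      by (blast intro: awalk_appendI)
  qed
  have "acyclic ?A"
  proof (rule acyclicI, rule allI, rule notI)
    fix u
    assume "(u, u) \<in> ?A\<^sup>+"
    then obtain v where uv: "(u, v) \<in> ?A" and vu: "(v, u) \<in> ?A\<^sup>*"
      by (blast dest: tranclD)
    from uv have "u \<noteq> v"
      by auto
    with vu obtain q where "awalk v q u"
      using walk by (auto simp: rtrancl_eq_or_trancl)
    moreover from uv obtain j p where "j \<in> {1..k}" "colored_path D c j u p v"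
      by blast
    ultimately have "?close v u"
      using colored_path_reverse[OF assms(4)] by blast
    with uv show False
      by blast
  qed
  then obtain K where K: "K \<subseteq> verts D"
      "\<forall>u\<in>verts D - K. \<exists>v\<in>K. ?close u v"
      "\<forall>u\<in>K. \<forall>v\<in>K. u \<noteq> v \<longrightarrow> \<not> ?close u v"
    using kernel_if_asymmetric_part_acyclic[OF finite_verts, of ?close] by blast
  then have "K \<noteq> {}"
    using assms(2) by blast
  with K show "\<exists>K. colored_kernel D c k K"
    unfolding colored_kernel_def colored_absorbent_def colored_independent_def by blast
qed

end
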